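(* Let $f(z)=\sum_{k=1}^\infty a_kz^{n_k}$, with all $a_k\ne0$ and $n_k$ positive integers, be analytic on $D_1$ and bounded there by $1$. Assume that there exists $q>2$ such that for any $k\ge1$ $$n_k^2<n_{k+1}\le n_k^q.$$ Then the transcendence sequence $(\nu_d)_{d\ge1}$ of $f$ grows at most polynomially in $d$. More accurately, we have $$\nu_d(f)<d^{q^2}.$$ If, in addition, for a certain fixed $p>0$ and for any $k\ge1$ we have $|a_k|\ge e^{-n_k^p}$, then on $D_{1/4}$ $$\mathcal{Z}_d(f)\le 10(2d)^{q^2}\big(1+qd^2+5d^{pq+3}\big).$$
   Context: $D_r=\{z\in\mathbb{C}:|z|\le r\}$. For $d\ge1$, the $d$-th transcendence index $\nu_d=\nu_d(f)$ of $f$ is the maximal multiplicity at $0$ of $P(z,f(z))$ over all non-zero $P\in\mathbb{C}[X,Y]$ of total degree at most $d$; $(\nu_d)_{d\ge1}$ is the transcendence sequence of $f$. For $d\ge1$, $\mathcal{Z}_d(f)$ on $D_{1/4}$ is the maximum, over all $(p_0,\dots,p_d)\ne(0,\dots,0)$ with $p_j\in\mathbb{C}[z]$, $\deg p_j\le d$, of the number of zeroes (counted with multiplicity) in $D_{1/4}$ of $\sum_{j=0}^dp_j(z)f(z)^j$.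
   Formalization: The bounds on ν_d(f) and Z_d(f) are stated for d ≥ n_1 only: at d = 1 the first fails for every such f (ν_1 ≥ n_1 ≥ 2 > 1), and for small d both fail when n_1 is large; polynomial growth of ν_d is stated for all d ≥ 1. *)

theory Defs
  imports
    "HOL-Complex_Analysis.Complex_Analysis"
    "HOL-Computational_Algebra.Polynomial"
    "HOL-Library.Extended_Real"
begin

text \<open>
  A polynomial in \<open>X, Y\<close> is an element of \<open>(\<complex>[X])[Y]\<close>: the coefficient of
  \<open>X\<^sup>i Y\<^sup>j\<close> is \<open>coeff (coeff P j) i\<close>.
\<close>

definition eval2 :: "complex poly poly \<Rightarrow> complex \<Rightarrow> complex \<Rightarrow> complex" where
  "eval2 P x y = (\<Sum>j\<le>degree P. poly (coeff P j) x * y ^ j)"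

definition total_degree_le :: "complex poly poly \<Rightarrow> nat \<Rightarrow> bool" where
  "total_degree_le P d \<longleftrightarrow> (\<forall>i j. coeff (coeff P j) i \<noteq> 0 \<longrightarrow> i + j \<le> d)"

text \<open>
  Multiplicity of an analytic function at a point. It is \<open>0\<close> where the function does not
  vanish. The infinite case is separated because \<open>zorder\<close> is unspecified for a function
  vanishing identically near the point.
\<close>

definition zero_mult :: "(complex \<Rightarrow> complex) \<Rightarrow> complex \<Rightarrow> enat" where
  "zero_mult g z =
     (if \<forall>\<^sub>F w in nhds z. g w = 0 then \<infinity> else enat (nat (zorder g z)))"

definition num_zeros :: "(complex \<Rightarrow> complex) \<Rightarrow> complex set \<Rightarrow> enat" where
  "num_zeros g S =
     (if finite {z \<in> S. g z = 0} then (\<Sum>z | z \<in> S \<and> g z = 0. zero_mult g z) else \<infinity>)"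

text \<open>
  The two maxima below are suprema in \<^typ>\<open>enat\<close>. Any finite value is attained, and the
  value is \<open>\<infinity>\<close> when no maximum exists, so a finite bound asserts that the maximum exists.
\<close>

definition transcendence_index :: "(complex \<Rightarrow> complex) \<Rightarrow> nat \<Rightarrow> enat" where
  "transcendence_index f d =
     (SUP P \<in> {P. P \<noteq> 0 \<and> total_degree_le P d}. zero_mult (\<lambda>z. eval2 P z (f z)) 0)"

definition max_zeros :: "(complex \<Rightarrow> complex) \<Rightarrow> complex set \<Rightarrow> nat \<Rightarrow> enat" where
  "max_zeros f S d =
     (SUP p \<in> {p :: nat \<Rightarrow> complex poly. (\<forall>j\<le>d. degree (p j) \<le> d) \<and> (\<exists>j\<le>d. p j \<noteq> 0)}.
        num_zeros (\<lambda>z. \<Sum>j\<le>d. poly (p j) z * f z ^ j) S)"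

end

theory Submission
  imports Defs
begin

text \<open>
  Given \<open>d \<ge> n\<^sub>1\<close>, choose \<open>k\<close> with \<open>n\<^sub>k \<le> d < n\<^bsub>k+1\<^esub>\<close> and let \<open>N = n\<^bsub>k+1\<^esub>\<close>, \<open>L = n\<^bsub>k+2\<^esub>\<close>, so that
  \<open>N \<le> d powr q\<close>, \<open>L \<le> d powr q\<^sup>2\<close> and \<open>d + d N < N\<^sup>2 < L\<close>. Below degree \<open>L\<close> the power \<open>f\<^sup>j\<close> is a polynomial of
  degree \<open>j N\<close> with leading coefficient \<open>\<alpha>\<^sup>j\<close>, where \<open>\<alpha> = a\<^bsub>k+1\<^esub>\<close>. As \<open>d < N\<close>, the degrees \<open>i + j N\<close> of the
  \<open>z\<^sup>i f\<^sup>j\<close> with \<open>i, j \<le> d\<close> are distinct, hence the map from the coefficients of \<open>P\<close> to the Taylor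
  coefficients of \<open>P(z, f(z))\<close> of index \<open>\<le> d + d N\<close> is injective, being triangular with diagonal
  entries \<open>\<alpha>\<^sup>j\<close>. This bounds the multiplicity at \<open>0\<close>. Quantitatively, all entries of the triangular
  system are at most \<open>1\<close> by Cauchy's inequality, so some Taylor coefficient of index \<open>\<le> d + d N\<close> is
  bounded below; dividing out the zeros in the disc of radius \<open>1/4\<close> and applying the maximum
  principle shows that many zeros would make that coefficient too small.
\<close>

section \<open>Zeros in a disc and the size of Taylor coefficients\<close>

lemma Cauchy_fps_bound:
  assumes "g analytic_on cball 0 r" "r > 0" "g has_fps_expansion G"
    and "\<And>z. norm z = r \<Longrightarrow> norm (g z) \<le> B"
  shows "norm (fps_nth G m) \<le> B / r ^ m"
proof -
  have "g holomorphic_on cball 0 r"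
    using assms(1) by (rule analytic_imp_holomorphic)
  then have "norm ((deriv ^^ m) g 0) \<le> fact m * B / r ^ m"
    using assms
    by (intro Cauchy_inequality) (auto intro: holomorphic_on_subset holomorphic_on_imp_continuous_on)
  then show ?thesis
    by (simp add: fps_nth_fps_expansion[OF assms(3)] norm_divide field_simps)
qed

text \<open>The quotient of \<open>g\<close> by the product is analytic away from \<open>Z\<close>.
  At a point of \<open>Z\<close> it is a removable 0/0, so \<open>h\<close> takes there the value
  given by the local factor \<open>k\<close>. The factorization is stated off \<open>Z\<close> only;
  at its zeros, \<open>g\<close> is handled directly by the caller.\<close>

lemma divide_out_zeros:
  fixes g :: "complex \<Rightarrow> complex"
  assumes g: "g analytic_on A" and fin: "finite Z"
    and loc: "\<And>z. z \<in> Z \<Longrightarrow> \<exists>k. k analytic_on {z} \<and> (\<forall>\<^sub>F w in nhds z. g w = k w * (w - z) ^ n z)"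
  obtains h where "h analytic_on A" "\<And>w. w \<notin> Z \<Longrightarrow> g w = h w * (\<Prod>z\<in>Z. (w - z) ^ n z)"
proof -
  obtain k where k: "\<And>z. z \<in> Z \<Longrightarrow> k z analytic_on {z}"
      "\<And>z. z \<in> Z \<Longrightarrow> \<forall>\<^sub>F w in nhds z. g w = k z w * (w - z) ^ n z"
    using loc by metis
  define h where "h = (\<lambda>w. if w \<in> Z then k w w / (\<Prod>z\<in>Z - {w}. (w - z) ^ n z)
                           else g w / (\<Prod>z\<in>Z. (w - z) ^ n z))"
  have "h analytic_on {w}" if "w \<in> A" for w
  proof (cases "w \<in> Z")
    case False
    have an: "(\<lambda>w. g w / (\<Prod>z\<in>Z. (w - z) ^ n z)) analytic_on {w}"
      using False fin analytic_on_subset[OF g, of "{w}"] that by (intro analytic_intros) auto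
    have ev: "\<forall>\<^sub>F v in nhds w. g v / (\<Prod>z\<in>Z. (v - z) ^ n z) = h v"
    proof -
      have "open (- Z)" using fin by (simp add: finite_imp_closed open_Compl)
      then have "\<forall>\<^sub>F v in nhds w. v \<in> - Z" using False by (intro eventually_nhds_in_open) auto
      then show ?thesis by eventually_elim (auto simp: h_def)
    qed
    show ?thesis using an analytic_at_cong[OF ev refl] by simp
  next
    case True
    have an: "(\<lambda>v. k w v / (\<Prod>z\<in>Z - {w}. (v - z) ^ n z)) analytic_on {w}"
      using True fin k(1) by (intro analytic_intros) auto
    have ev: "\<forall>\<^sub>F v in nhds w. k w v / (\<Prod>z\<in>Z - {w}. (v - z) ^ n z) = h v"
    proof -
      have "open (- (Z - {w}))" using fin by (intro open_Compl finite_imp_closed) auto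
      then have "\<forall>\<^sub>F v in nhds w. v \<in> - (Z - {w})" by (intro eventually_nhds_in_open) auto
      with k(2)[OF True] show ?thesis
      proof eventually_elim
        case (elim v)
        have "(\<Prod>z\<in>Z. (v - z) ^ n z) = (v - w) ^ n w * (\<Prod>z\<in>Z - {w}. (v - z) ^ n z)"
          using True fin by (subst prod.remove[of _ w]) auto
        moreover have "(\<Prod>z\<in>Z - {w}. (w - z) ^ n z) \<noteq> 0" using fin by auto
        ultimately show ?case using elim True by (cases "v = w") (auto simp: h_def)
      qed
    qed
    show ?thesis using an analytic_at_cong[OF ev refl] by simp
  qed
  then have "h analytic_on A" using analytic_on_analytic_at by blast
  moreover have "g w = h w * (\<Prod>z\<in>Z. (w - z) ^ n z)" if "w \<notin> Z" for w
    using that fin by (auto simp: h_def)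
  ultimately show ?thesis using that by blast
qed

text \<open>For \<open>N\<close> zeros in the disc of radius 1/4, write \<open>g\<close> as
  \<open>h\<close> times \<open>N\<close> linear factors. On the unit circle each factor is at least
  3/4, so by the maximum principle \<open>h\<close> is at most \<open>B * (4/3)^N\<close> inside. On
  the circle of radius 1/4 each factor is at most 1/2, so \<open>g\<close> is at most
  \<open>B * (2/3)^N\<close> there; Cauchy's inequality on that circle costs the factor
  \<open>4^m\<close>.\<close>

lemma num_zeros_and_fps_nth_decay:
  assumes g: "g analytic_on cball 0 1" and bd: "\<And>z. norm z = 1 \<Longrightarrow> norm (g z) \<le> B"
    and G: "g has_fps_expansion G" and m: "fps_nth G m \<noteq> 0"
  obtains N where "num_zeros g (cball 0 (1/4)) = enat N"
    "norm (fps_nth G m) \<le> B * (2/3) ^ N * 4 ^ m"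
proof -
  let ?C = "cball 0 (1/4) :: complex set"
  let ?b = "ball 0 1 :: complex set"
  have hol: "g holomorphic_on ?b"
    using g analytic_imp_holomorphic ball_subset_cball holomorphic_on_subset by blast
  \<comment> \<open>By the identity theorem, vanishing near one point of the open unit disc would
    spread to 0 and kill the coefficient of index \<open>m\<close>.\<close>
  have ev: "\<not> (\<forall>\<^sub>F w in nhds z. g w = 0)" if "z \<in> ?b" for z
  proof
    assume "\<forall>\<^sub>F w in nhds z. g w = 0"
    then have "\<forall>\<^sub>F w in nhds z. w \<in> ?b \<and> g w = 0"
      using that by (intro eventually_conj eventually_nhds_in_open) auto
    then obtain U where U: "open U" "z \<in> U" "\<forall>w\<in>U. w \<in> ?b \<and> g w = 0"
      unfolding eventually_nhds by blast
    have "g w = 0" if "w \<in> ?b" for w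
      by (rule analytic_continuation_open[of U ?b g "\<lambda>_. 0"])
         (use U that hol in auto)
    moreover have "\<forall>\<^sub>F w in nhds 0. w \<in> ?b" by (intro eventually_nhds_in_open) auto
    ultimately have "\<forall>\<^sub>F w in nhds 0. g w = 0" by (auto elim: eventually_mono)
    then have "g has_fps_expansion 0" by (simp add: has_fps_expansion_0_iff)
    then show False using fps_nth_fps_expansion[OF G, of m] fps_nth_fps_expansion[of g 0 m] m by auto
  qed
  have nz: "\<exists>w\<in>?b. g w \<noteq> 0"
  proof (rule ccontr)
    assume "\<not> ?thesis"
    moreover have "\<forall>\<^sub>F w in nhds 0. w \<in> ?b" by (intro eventually_nhds_in_open) auto
    ultimately have "\<forall>\<^sub>F w in nhds 0. g w = 0" by (auto elim: eventually_mono)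
    then show False using ev[of 0] by simp
  qed
  define Z where "Z = {z \<in> ?C. g z = 0}"
  define n where "n = (\<lambda>z. nat (zorder g z))"
  define N where "N = (\<Sum>z\<in>Z. n z)"
  \<comment> \<open>The finiteness theorem for zeros on a compact set concerns nonconstant
    functions; a constant \<open>g\<close> is a nonzero constant here and has no zeros.\<close>
  have fin: "finite Z"
  proof (cases "g constant_on ?b")
    case True
    then have "Z = {}" using nz by (force simp: constant_on_def Z_def)
    then show ?thesis by simp
  next
    case False
    then show ?thesis unfolding Z_def
      by (intro holomorphic_compact_finite_zeros[OF hol]) auto
  qed
  have Zb: "z \<in> ?b" if "z \<in> Z" for z using that by (auto simp: Z_def)
  have zm: "zero_mult g z = enat (n z)" if "z \<in> Z" for z
    using ev[OF Zb[OF that]] by (simp add: zero_mult_def n_def)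
  have "(\<Sum>z\<in>Z. zero_mult g z) = enat N"
  proof -
    have "(\<Sum>z\<in>Z. zero_mult g z) = (\<Sum>z\<in>Z. of_nat (n z))" by (intro sum.cong) (auto simp: zm of_nat_eq_enat)
    then show ?thesis by (simp add: N_def flip: of_nat_eq_enat)
  qed
  then have num: "num_zeros g ?C = enat N" using fin by (simp add: num_zeros_def Z_def)
  have "\<exists>k. k analytic_on {z} \<and> (\<forall>\<^sub>F w in nhds z. g w = k w * (w - z) ^ n z)" if z: "z \<in> Z" for z
  proof -
    obtain r where r: "r > 0" "zor_poly g z holomorphic_on cball z r"
       "\<forall>w\<in>cball z r. g w = zor_poly g z w * (w - z) ^ n z"
      using zorder_exist_zero[OF hol _ _ Zb[OF z] nz] unfolding n_def by auto
    have "zor_poly g z holomorphic_on ball z r" using r(2) by (rule holomorphic_on_subset) auto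
    then have "zor_poly g z analytic_on {z}" using r(1) by (auto simp: analytic_at intro!: exI[of _ "ball z r"])
    moreover have "\<forall>\<^sub>F w in nhds z. w \<in> ball z r" using r(1) by (intro eventually_nhds_in_open) auto
    then have "\<forall>\<^sub>F w in nhds z. g w = zor_poly g z w * (w - z) ^ n z"
      by eventually_elim (use r in auto)
    ultimately show ?thesis by blast
  qed
  then obtain h where h: "h analytic_on cball 0 1"
      "\<And>w. w \<notin> Z \<Longrightarrow> g w = h w * (\<Prod>z\<in>Z. (w - z) ^ n z)"
    using divide_out_zeros[OF g fin, of n] by blast
  have B0: "B \<ge> 0" using order_trans[OF norm_ge_zero bd[of 1]] by simp
  have hb: "norm (h w) \<le> B / (3/4) ^ N" if "norm w \<le> 1" for w
  proof (rule maximum_modulus_frontier[where S = "cball 0 1" and f = h and \<xi> = w])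
    show "h holomorphic_on interior (cball 0 1)"
      using h(1) analytic_imp_holomorphic holomorphic_on_subset interior_subset by blast
    show "continuous_on (closure (cball 0 1)) h"
      using h(1) analytic_imp_holomorphic holomorphic_on_imp_continuous_on by auto
    fix v :: complex assume "v \<in> frontier (cball 0 1)"
    then have v: "norm v = 1" by simp
    then have "v \<notin> Z" by (auto simp: Z_def)
    have "(3/4) ^ N \<le> norm (\<Prod>z\<in>Z. (v - z) ^ n z)"
      unfolding N_def power_sum prod_norm[symmetric] norm_power
    proof (intro prod_mono conjI power_mono)
      fix z assume "z \<in> Z"
      then show "3/4 \<le> norm (v - z)" using v norm_triangle_ineq2[of v z] by (auto simp: Z_def)
    qed auto
    then have "norm (h v) * (3/4) ^ N \<le> norm (h v) * norm (\<Prod>z\<in>Z. (v - z) ^ n z)"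
      by (intro mult_left_mono) auto
    also have "\<dots> = norm (g v)" using h(2)[OF \<open>v \<notin> Z\<close>] by (simp add: norm_mult)
    also have "\<dots> \<le> B" using bd v by auto
    finally show "norm (h v) \<le> B / (3/4) ^ N" by (simp add: field_simps)
  qed (use that in auto)
  have "norm (fps_nth G m) \<le> (B * (2/3) ^ N) / (1/4) ^ m"
  proof (rule Cauchy_fps_bound[OF _ _ G])
    show "g analytic_on ?C" using g by (rule analytic_on_subset) auto
    fix w :: complex assume w: "norm w = 1/4"
    show "norm (g w) \<le> B * (2/3) ^ N"
    proof (cases "w \<in> Z")
      case True
      then show ?thesis using B0 by (simp add: Z_def)
    next
      case False
      have "norm (\<Prod>z\<in>Z. (w - z) ^ n z) \<le> (1/2) ^ N"
        unfolding N_def power_sum prod_norm[symmetric] norm_power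
      proof (intro prod_mono conjI power_mono)
        fix z assume "z \<in> Z"
        then show "norm (w - z) \<le> 1/2" using w norm_triangle_ineq4[of w z] by (auto simp: Z_def)
      qed auto
      then have "norm (g w) \<le> B / (3/4) ^ N * (1/2) ^ N"
        unfolding h(2)[OF False] norm_mult using hb[of w] w B0 by (intro mult_mono) auto
      also have "\<dots> = B * (2/3) ^ N"
      proof -
        have "(2/3::real) ^ N = (1/2) ^ N / (3/4) ^ N" by (simp flip: power_divide)
        then show ?thesis by simp
      qed
      finally show ?thesis .
    qed
  qed auto
  then have "norm (fps_nth G m) \<le> B * (2/3) ^ N * 4 ^ m" by (simp add: power_divide)
  with num that show ?thesis by blast
qed

section \<open>Powers of a gap series and the triangular system\<close>

text \<open>Induction through the Cauchy product at an index \<open>m\<close> with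
  \<open>(j + 1) * N \<le> m < L\<close>. A factor of \<open>F\<close> with index
  \<open>i > N\<close> lies in the gap. For \<open>i \<le> N\<close> the factor of
  \<open>F ^ j\<close> has index \<open>m - i \<ge> j * N\<close> and vanishes unless equality
  holds, which forces \<open>i = N\<close> and \<open>m = (j + 1) * N\<close>; that single term
  yields the leading coefficient.\<close>

lemma fps_power_gap:
  fixes F :: "'a::comm_ring_1 fps"
  assumes gap: "\<And>m. N < m \<Longrightarrow> m < L \<Longrightarrow> fps_nth F m = 0"
  shows "j * N < m \<Longrightarrow> m < L \<Longrightarrow> fps_nth (F ^ j) m = 0"
    and "j * N < L \<Longrightarrow> fps_nth (F ^ j) (j * N) = fps_nth F N ^ j"
proof -
  have "(\<forall>m. j * N < m \<and> m < L \<longrightarrow> fps_nth (F ^ j) m = 0) \<and>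
        (j * N < L \<longrightarrow> fps_nth (F ^ j) (j * N) = fps_nth F N ^ j)"
  proof (induction j)
    case 0
    then show ?case by simp
  next
    case (Suc j)
    have z: "fps_nth F i * fps_nth (F ^ j) (m - i) = 0"
      if "Suc j * N \<le> m" "m < L" "i \<le> m" "m = Suc j * N \<longrightarrow> i \<noteq> N" for m i
    proof (cases "i \<le> N")
      case True
      then have "j * N < m - i" using that by (cases "i = N") auto
      then show ?thesis using Suc that by auto
    next
      case False
      then show ?thesis using gap[of i] that by auto
    qed
    have 1: "fps_nth (F ^ Suc j) m = 0" if "Suc j * N < m" "m < L" for m
      using z[of m] that by (auto simp: fps_mult_nth intro!: sum.neutral)
    have 2: "fps_nth (F ^ Suc j) (Suc j * N) = fps_nth F N ^ Suc j" if "Suc j * N < L"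
    proof -
      have "fps_nth (F ^ Suc j) (Suc j * N)
          = (\<Sum>i\<in>{N}. fps_nth F i * fps_nth (F ^ j) (Suc j * N - i))"
        unfolding power_Suc fps_mult_nth using z[of "Suc j * N"] that
        by (intro sum.mono_neutral_right) auto
      then show ?thesis using Suc that by auto
    qed
    from 1 2 show ?case by auto
  qed
  then show "j * N < m \<Longrightarrow> m < L \<Longrightarrow> fps_nth (F ^ j) m = 0"
    and "j * N < L \<Longrightarrow> fps_nth (F ^ j) (j * N) = fps_nth F N ^ j" by auto
qed

text \<open>
  Weighting the unknowns by \<open>R\<^sup>\<tau>\<close> with \<open>R = 1 + 2 / \<delta>\<close> makes the geometric tail \<open>R\<^sup>-\<^sup>1 + R\<^sup>-\<^sup>2 + \<dots>\<close> equal to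
  \<open>\<delta> / 2\<close>, so in the row of the largest weighted unknown the diagonal term beats all later ones.
\<close>
lemma weighted_max_dominates:
  fixes x :: "'a \<Rightarrow> complex" and e :: "'a \<Rightarrow> 'a \<Rightarrow> complex" and \<tau> :: "'a \<Rightarrow> nat"
  assumes fin: "finite I" and inj: "inj_on \<tau> I" and \<delta>: "0 < \<delta>"
    and bd: "\<And>u v. u \<in> I \<Longrightarrow> v \<in> I \<Longrightarrow> norm (e v u) \<le> 1"
    and lower: "\<And>u v. u \<in> I \<Longrightarrow> v \<in> I \<Longrightarrow> \<tau> u < \<tau> v \<Longrightarrow> e v u = 0"
    and diag: "\<And>u. u \<in> I \<Longrightarrow> \<delta> \<le> norm (e u u)"
    and M: "\<And>u. u \<in> I \<Longrightarrow> \<tau> u \<le> M"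
    and u0: "u0 \<in> I"
  shows "\<exists>v\<in>I. norm (x u0) * (\<delta> / 2) / (1 + 2 / \<delta>) ^ M \<le> norm (\<Sum>u\<in>I. x u * e v u)"
proof -
  define R where "R = 1 + 2 / \<delta>"
  define r where "r = 1 / R"
  have R: "R > 1" using \<delta> by (simp add: R_def)
  have r: "0 < r" "r < 1" using R by (auto simp: r_def)
  have r_sum: "r / (1 - r) = \<delta> / 2" using \<delta> by (simp add: r_def R_def field_simps)
  define w where "w = (\<lambda>u. norm (x u) * R ^ \<tau> u)"
  have "\<exists>v\<in>I. \<forall>u\<in>I. w u \<le> w v"
  proof -
    have "Max (w ` I) \<in> w ` I" using fin u0 by (intro Max_in) auto
    then show ?thesis using fin by (metis (no_types, lifting) Max_ge finite_imageI imageE imageI)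
  qed
  then obtain v where v: "v \<in> I" and wv: "\<And>u. u \<in> I \<Longrightarrow> w u \<le> w v" by blast
  define J where "J = {u \<in> I. \<tau> v < \<tau> u}"
  \<comment> \<open>Row \<open>v\<close> has no entries at unknowns with smaller \<tau>, and
    injectivity of \<tau> excludes ties, so only the diagonal and later terms remain.\<close>
  have split: "(\<Sum>u\<in>I. x u * e v u) = x v * e v v + (\<Sum>u\<in>J. x u * e v u)"
  proof -
    have "(\<Sum>u\<in>I. x u * e v u) = (\<Sum>u\<in>insert v J. x u * e v u)"
    proof (rule sum.mono_neutral_right)
      show "\<forall>u\<in>I - insert v J. x u * e v u = 0"
      proof
        fix u assume u: "u \<in> I - insert v J"
        then have "\<tau> u \<noteq> \<tau> v" using inj v by (auto dest: inj_onD)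
        then have "\<tau> u < \<tau> v" using u by (auto simp: J_def)
        then show "x u * e v u = 0" using lower u v by auto
      qed
    qed (use fin v J_def in auto)
    then show ?thesis using fin by (simp add: J_def)
  qed
  \<comment> \<open>Maximality of the weight of \<open>v\<close> forces geometric decay of the later
    unknowns.\<close>
  have xle: "norm (x u) \<le> norm (x v) * r ^ (\<tau> u - \<tau> v)" if "u \<in> J" for u
  proof -
    have "norm (x u) * R ^ (\<tau> u - \<tau> v) * R ^ \<tau> v \<le> norm (x v) * R ^ \<tau> v"
      using wv[of u] that by (simp add: w_def J_def mult.assoc flip: power_add)
    then have "norm (x u) * R ^ (\<tau> u - \<tau> v) \<le> norm (x v)" using R by simp
    then show ?thesis using R by (simp add: r_def power_divide field_simps)
  qed
  have "norm (\<Sum>u\<in>J. x u * e v u) \<le> (\<Sum>u\<in>J. norm (x v) * r ^ (\<tau> u - \<tau> v))"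
  proof (rule sum_norm_le)
    fix u assume u: "u \<in> J"
    have "norm (x u) * norm (e v u) \<le> norm (x u) * 1"
      using bd[of u v] u v by (intro mult_left_mono) (auto simp: J_def)
    then show "norm (x u * e v u) \<le> norm (x v) * r ^ (\<tau> u - \<tau> v)"
      using xle[OF u] by (simp add: norm_mult)
  qed
  also have "\<dots> = norm (x v) * (\<Sum>u\<in>J. r ^ (\<tau> u - \<tau> v))" by (simp add: sum_distrib_left)
  \<comment> \<open>The exponents are distinct and positive, so the sum is dominated by a geometric
    series starting at \<open>r\<close>.\<close>
  also have "(\<Sum>u\<in>J. r ^ (\<tau> u - \<tau> v)) = (\<Sum>k\<in>(\<lambda>u. \<tau> u - \<tau> v) ` J. r ^ k)"
  proof (subst sum.reindex)
    show "inj_on (\<lambda>u. \<tau> u - \<tau> v) J"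
    proof (rule inj_onI)
      fix a b assume "a \<in> J" "b \<in> J" "\<tau> a - \<tau> v = \<tau> b - \<tau> v"
      then have "\<tau> a = \<tau> b" "a \<in> I" "b \<in> I" by (auto simp: J_def)
      then show "a = b" using inj by (auto dest: inj_onD)
    qed
  qed simp
  also have "\<dots> \<le> (\<Sum>k\<in>Suc ` {..<M}. r ^ k)"
  proof (rule sum_mono2)
    show "(\<lambda>u. \<tau> u - \<tau> v) ` J \<subseteq> Suc ` {..<M}"
    proof safe
      fix u assume "u \<in> J"
      then have "\<tau> u \<le> M" "\<tau> v < \<tau> u" using M by (auto simp: J_def)
      then show "\<tau> u - \<tau> v \<in> Suc ` {..<M}" by (intro image_eqI[of _ _ "\<tau> u - \<tau> v - 1"]) auto
    qed
  qed (use r in auto)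
  also have "(\<Sum>k\<in>Suc ` {..<M}. r ^ k) = r * (\<Sum>k<M. r ^ k)"
    by (subst sum.reindex) (auto simp: sum_distrib_left)
  also have "(\<Sum>k<M. r ^ k) = (1 - r ^ M) / (1 - r)"
    using r by (simp add: sum_gp_strict)
  also have "r * ((1 - r ^ M) / (1 - r)) \<le> \<delta> / 2"
    unfolding r_sum[symmetric] using r by (simp add: field_simps)
  finally have tail: "norm (\<Sum>u\<in>J. x u * e v u) \<le> norm (x v) * (\<delta> / 2)"
    by (simp add: mult_left_mono)
  have "norm (x v) * \<delta> \<le> norm (x v * e v v)"
    using diag[OF v] by (simp add: norm_mult mult_left_mono)
  then have main: "norm (x v) * (\<delta> / 2) \<le> norm (\<Sum>u\<in>I. x u * e v u)"
    unfolding split using tail norm_diff_ineq[of "x v * e v v" "\<Sum>u\<in>J. x u * e v u"] by simp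
  \<comment> \<open>The maximizing \<open>v\<close> need not be \<open>u0\<close>. Comparing weights
    bounds \<open>x v\<close> from below by \<open>x u0\<close>, at the price of
    \<open>R ^ M\<close>.\<close>
  have "norm (x u0) * 1 \<le> w u0"
    unfolding w_def using R by (intro mult_left_mono one_le_power) auto
  also have "\<dots> \<le> norm (x v) * R ^ \<tau> v" using wv[OF u0] by (simp add: w_def)
  also have "\<dots> \<le> norm (x v) * R ^ M"
    using R M[OF v] by (intro mult_left_mono power_increasing) auto
  finally have "norm (x u0) / R ^ M \<le> norm (x v)" using R by (simp add: field_simps)
  then have "norm (x u0) / R ^ M * (\<delta> / 2) \<le> norm (x v) * (\<delta> / 2)"
    using \<delta> by (intro mult_right_mono) auto
  then have "norm (x u0) * (\<delta> / 2) / R ^ M \<le> norm (x v) * (\<delta> / 2)" by simp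
  with main v show ?thesis unfolding R_def[symmetric] by (meson order_trans)
qed

text \<open>The unknowns are the coefficients of the \<open>p j\<close>, placed at row
  \<open>i + j * N\<close>, the degree of \<open>z^i f^j\<close> below \<open>L\<close>. From
  \<open>d < N\<close> it follows that these rows are distinct, and \<open>d + d * N < L\<close>
  keeps every row within reach of \<open>fps_power_gap\<close>. The diagonal entries are the powers
  \<open>fps_nth F N ^ j\<close>; since the base has norm at most 1 and \<open>j \<le> d\<close>,
  the number \<delta> bounds all of them from below.\<close>

lemma fps_poly_combination_lower_bound:
  fixes F :: "complex fps" and p :: "nat \<Rightarrow> complex poly"
  assumes gap: "\<And>m. N < m \<Longrightarrow> m < L \<Longrightarrow> fps_nth F m = 0" and nz: "fps_nth F N \<noteq> 0"
    and dN: "d < N" "d + d * N < L"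
    and F_le: "\<And>j m. norm (fps_nth (F ^ j) m) \<le> 1"
    and deg: "\<And>j. j \<le> d \<Longrightarrow> degree (p j) \<le> d"
    and ij: "i \<le> d" "j \<le> d"
  defines "G \<equiv> \<Sum>j\<le>d. fps_of_poly (p j) * F ^ j" and "\<delta> \<equiv> norm (fps_nth F N) ^ d"
  shows "\<exists>t\<le>d + d * N. norm (coeff (p j) i) * (\<delta> / 2) / (1 + 2 / \<delta>) ^ (d + d * N) \<le> norm (fps_nth G t)"
proof -
  define I where "I = {..d} \<times> {..d}"
  define \<tau> where "\<tau> = (\<lambda>(i, j). i + j * N)"
  define x where "x = (\<lambda>(i, j). coeff (p j) i)"
  \<comment> \<open>The guard prevents truncated subtraction from turning an index below
    \<open>i\<close> into index 0.\<close>
  define e where "e = (\<lambda>v (i, j). if i \<le> \<tau> v then fps_nth (F ^ j) (\<tau> v - i) else 0)"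
  have \<tau>M: "\<tau> u \<le> d + d * N" if "u \<in> I" for u
    using that by (auto simp: I_def \<tau>_def intro!: add_mono)
  have G: "fps_nth G (\<tau> v) = (\<Sum>u\<in>I. x u * e v u)" if "v \<in> I" for v
  proof -
    have "fps_nth (fps_of_poly (p j) * F ^ j) (\<tau> v) = (\<Sum>i\<le>d. x (i, j) * e v (i, j))"
      if "j \<le> d" for j
    proof -
      have "(\<Sum>i=0..\<tau> v. coeff (p j) i * fps_nth (F ^ j) (\<tau> v - i))
          = (\<Sum>i\<in>{0..\<tau> v} \<inter> {..d}. coeff (p j) i * fps_nth (F ^ j) (\<tau> v - i))"
        using deg[OF that] by (intro sum.mono_neutral_right) (auto simp: coeff_eq_0)
      also have "\<dots> = (\<Sum>i\<le>d. x (i, j) * e v (i, j))"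
        by (intro sum.mono_neutral_cong_left) (auto simp: x_def e_def)
      finally show ?thesis by (simp add: fps_mult_nth)
    qed
    then have "fps_nth G (\<tau> v) = (\<Sum>j\<le>d. \<Sum>i\<le>d. x (i, j) * e v (i, j))"
      by (simp add: G_def fps_sum_nth)
    also have "\<dots> = (\<Sum>i\<le>d. \<Sum>j\<le>d. x (i, j) * e v (i, j))" by (rule sum.swap)
    finally show ?thesis by (simp add: I_def sum.cartesian_product)
  qed
  have F1: "norm (fps_nth F N) \<le> 1" using F_le[of 1] by simp
  have "\<exists>v\<in>I. norm (x (i, j)) * (\<delta> / 2) / (1 + 2 / \<delta>) ^ (d + d * N)
          \<le> norm (\<Sum>u\<in>I. x u * e v u)"
  proof (rule weighted_max_dominates[where \<tau> = \<tau>])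
    show "inj_on \<tau> I"
    proof (rule inj_onI, clarsimp simp: I_def \<tau>_def)
      fix i j i' j' assume *: "i \<le> d" "i' \<le> d" "i + j * N = i' + j' * N"
      then have "i < N" "i' < N" using dN by auto
      then have "(i + j * N) mod N = i" "(i' + j' * N) mod N = i'" by auto
      then have "i = i'" using * by simp
      then show "i = i' \<and> j = j'" using * dN by simp
    qed
    show "e v u = 0" if uv: "u \<in> I" "v \<in> I" "\<tau> u < \<tau> v" for u v
    proof -
      obtain i j where u: "u = (i, j)" by (cases u)
      have "fps_nth (F ^ j) (\<tau> v - i) = 0"
        using uv u \<tau>M[of v] dN by (intro fps_power_gap(1)[OF gap]) (auto simp: \<tau>_def)
      then show ?thesis by (simp add: e_def u)
    qed
    show "\<delta> \<le> norm (e u u)" if "u \<in> I" for u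
    proof -
      obtain i j where u: "u = (i, j)" by (cases u)
      have "j * N < L" using \<tau>M[OF that] dN by (simp add: u \<tau>_def)
      then have "e u u = fps_nth F N ^ j"
        using fps_power_gap(2)[of N L F j, OF gap] by (simp add: e_def u \<tau>_def)
      then show ?thesis
        using F1 that by (auto simp: \<delta>_def norm_power u I_def intro!: power_decreasing)
    qed
  qed (use nz F_le \<tau>M ij in \<open>auto simp: I_def \<delta>_def e_def split: prod.splits\<close>)
  then obtain v where "v \<in> I"
     "norm (x (i, j)) * (\<delta> / 2) / (1 + 2 / \<delta>) ^ (d + d * N) \<le> norm (fps_nth G (\<tau> v))"
    using G by auto
  then show ?thesis using \<tau>M[of v] by (auto simp: x_def)
qed

section \<open>Taylor expansions of \<open>f\<close> and of polynomial combinations of its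
  powers\<close>

lemma fps_nth_power_le_one:
  assumes "f analytic_on cball 0 1" "\<And>z. z \<in> cball 0 1 \<Longrightarrow> norm (f z) \<le> 1" "f has_fps_expansion F"
  shows "norm (fps_nth (F ^ j) m) \<le> 1"
proof -
  have "norm (fps_nth (F ^ j) m) \<le> 1 / 1 ^ m"
  proof (rule Cauchy_fps_bound)
    show "(\<lambda>z. f z ^ j) analytic_on cball 0 1" using assms by (intro analytic_intros)
    show "(\<lambda>z. f z ^ j) has_fps_expansion F ^ j" using assms by (intro fps_expansion_intros)
  qed (use assms in \<open>auto simp: norm_power intro: power_le_one\<close>)
  then show ?thesis by simp
qed

lemma has_fps_expansion_poly:
  fixes p :: "complex poly"
  shows "poly p has_fps_expansion fps_of_poly p"
proof (rule has_fps_expansionI)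
  show "\<forall>\<^sub>F u in nhds 0. (\<lambda>n. fps_nth (fps_of_poly p) n * u ^ n) sums poly p u"
    using sums_finite[of "{..degree p}" "\<lambda>n. coeff p n * u ^ n" for u]
    by (intro always_eventually allI) (auto simp: poly_altdef coeff_eq_0)
qed

lemma zero_mult_has_fps_expansion:
  assumes "g has_fps_expansion G" "fps_nth G t \<noteq> 0"
  shows "zero_mult g 0 \<le> enat t"
proof -
  have "G \<noteq> 0" using assms by auto
  have "\<not> (\<forall>\<^sub>F w in nhds 0. g w = 0)"
  proof
    assume "\<forall>\<^sub>F w in nhds 0. g w = 0"
    then have "g has_fps_expansion 0" by (simp add: has_fps_expansion_0_iff)
    then show False
      using fps_nth_fps_expansion[OF assms(1), of t] fps_nth_fps_expansion[of g 0 t] assms by simp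
  qed
  then show ?thesis
    using has_fps_expansion_zorder_0[OF assms(1) \<open>G \<noteq> 0\<close>] subdegree_leI[OF assms(2)]
    by (simp add: zero_mult_def)
qed

text \<open>Regroups the series by exponent. Strict monotonicity ensures that each exponent occurs
  at most once, so \<open>the_inv n\<close> recovers its coefficient.\<close>

lemma lacunary_series_expansion:
  fixes f :: "complex \<Rightarrow> complex" and a :: "nat \<Rightarrow> complex" and n :: "nat \<Rightarrow> nat"
  assumes sums: "\<And>z. z \<in> cball 0 1 \<Longrightarrow> (\<lambda>k. a k * z ^ n k) sums f z" and mono: "strict_mono n"
  obtains F where "f has_fps_expansion F" "\<And>k. fps_nth F (n k) = a k"
    "\<And>m. m \<notin> range n \<Longrightarrow> fps_nth F m = 0"
proof -
  define F where "F = Abs_fps (\<lambda>m. if m \<in> range n then a (the_inv n m) else 0)"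
  have inj: "inj n" using mono by (rule strict_mono_imp_inj_on)
  have F1: "fps_nth F (n k) = a k" for k using inj by (simp add: F_def the_inv_f_f)
  have F2: "fps_nth F m = 0" if "m \<notin> range n" for m using that by (simp add: F_def)
  have "f has_fps_expansion F"
  proof (rule has_fps_expansionI)
    have "\<forall>\<^sub>F u in nhds 0. u \<in> ball (0::complex) 1" by (intro eventually_nhds_in_open) auto
    then show "\<forall>\<^sub>F u in nhds 0. (\<lambda>m. fps_nth F m * u ^ m) sums f u"
    proof eventually_elim
      case (elim u)
      have "(\<lambda>k. fps_nth F (n k) * u ^ n k) sums f u" using sums[of u] elim by (simp add: F1)
      then show ?case
        using sums_mono_reindex[OF mono, of "\<lambda>m. fps_nth F m * u ^ m" "f u"] F2 by simp
    qed
  qed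
  with F1 F2 that show ?thesis by blast
qed

lemma eval2_extend:
  assumes "degree P \<le> d"
  shows "eval2 P x y = (\<Sum>j\<le>d. poly (coeff P j) x * y ^ j)"
  unfolding eval2_def using assms by (intro sum.mono_neutral_left) (auto simp: coeff_eq_0)

lemma has_fps_expansion_poly_combination:
  fixes f :: "complex \<Rightarrow> complex"
  assumes "f has_fps_expansion F"
  shows "(\<lambda>z. \<Sum>j\<le>d. poly (p j) z * f z ^ j) has_fps_expansion (\<Sum>j\<le>d. fps_of_poly (p j) * F ^ j)"
  by (intro fps_expansion_intros has_fps_expansion_poly assms)

section \<open>Multiplicity at 0 and the transcendence index\<close>

text \<open>Applied to the leading coefficient of a nonzero \<open>p j\<close>, the quantitative
  lower bound is positive, so some Taylor coefficient of index at most \<open>d + d * N\<close>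
  survives.\<close>

lemma zero_mult_poly_combination_le:
  fixes f :: "complex \<Rightarrow> complex" and p :: "nat \<Rightarrow> complex poly"
  assumes f: "f analytic_on cball 0 1" "\<And>z. z \<in> cball 0 1 \<Longrightarrow> norm (f z) \<le> 1"
    and F: "f has_fps_expansion F"
    and gap: "\<And>m. N < m \<Longrightarrow> m < L \<Longrightarrow> fps_nth F m = 0" and nz: "fps_nth F N \<noteq> 0"
    and dN: "d < N" "d + d * N < L"
    and deg: "\<And>j. j \<le> d \<Longrightarrow> degree (p j) \<le> d" and p: "j \<le> d" "p j \<noteq> 0"
  shows "zero_mult (\<lambda>z. \<Sum>j\<le>d. poly (p j) z * f z ^ j) 0 \<le> enat (d + d * N)"
proof -
  define G where "G = (\<Sum>j\<le>d. fps_of_poly (p j) * F ^ j)"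
  define \<delta> where "\<delta> = norm (fps_nth F N) ^ d"
  have "\<exists>t\<le>d + d * N. norm (coeff (p j) (degree (p j))) * (\<delta> / 2) / (1 + 2 / \<delta>) ^ (d + d * N)
          \<le> norm (fps_nth G t)"
    unfolding G_def \<delta>_def
    by (rule fps_poly_combination_lower_bound[OF gap nz dN fps_nth_power_le_one[OF f F] deg deg[OF p(1)] p(1)])
  then obtain t where t: "t \<le> d + d * N"
      "norm (coeff (p j) (degree (p j))) * (\<delta> / 2) / (1 + 2 / \<delta>) ^ (d + d * N) \<le> norm (fps_nth G t)"
    by blast
  have "\<delta> > 0" using nz by (simp add: \<delta>_def)
  then have "0 < norm (coeff (p j) (degree (p j))) * (\<delta> / 2) / (1 + 2 / \<delta>) ^ (d + d * N)"
    using p by (intro divide_pos_pos mult_pos_pos zero_less_power add_pos_pos) auto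
  with t(2) have "fps_nth G t \<noteq> 0" by auto
  then have "zero_mult (\<lambda>z. \<Sum>j\<le>d. poly (p j) z * f z ^ j) 0 \<le> enat t"
    unfolding G_def by (intro zero_mult_has_fps_expansion[OF has_fps_expansion_poly_combination[OF F]])
  also have "\<dots> \<le> enat (d + d * N)" using t(1) by simp
  finally show ?thesis .
qed

lemma transcendence_index_le:
  fixes f :: "complex \<Rightarrow> complex"
  assumes f: "f analytic_on cball 0 1" "\<And>z. z \<in> cball 0 1 \<Longrightarrow> norm (f z) \<le> 1"
    and F: "f has_fps_expansion F"
    and gap: "\<And>m. N < m \<Longrightarrow> m < L \<Longrightarrow> fps_nth F m = 0" and nz: "fps_nth F N \<noteq> 0"
    and dN: "d < N" "d + d * N < L"
  shows "transcendence_index f d \<le> enat (d + d * N)"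
  unfolding transcendence_index_def
proof (rule SUP_least, clarify)
  fix P :: "complex poly poly" assume P: "P \<noteq> 0" "total_degree_le P d"
  have deg: "degree (coeff P j) \<le> d" for j
    using P(2) unfolding total_degree_le_def by (intro degree_le) (metis add_leD1 not_le)
  have lead: "degree P \<le> d"
    using P unfolding total_degree_le_def
    by (metis add_leD2 leading_coeff_0_iff)
  have "zero_mult (\<lambda>z. \<Sum>j\<le>d. poly (coeff P j) z * f z ^ j) 0 \<le> enat (d + d * N)"
    using zero_mult_poly_combination_le[OF f F gap nz dN deg lead] P(1) by simp
  then show "zero_mult (\<lambda>z. eval2 P z (f z)) 0 \<le> enat (d + d * N)"
    by (simp add: eval2_extend[OF lead])
qed

lemma transcendence_index_mono:
  assumes "d \<le> d'"
  shows "transcendence_index f d \<le> transcendence_index f d'"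
  unfolding transcendence_index_def
proof (rule SUP_subset_mono)
  show "{P. P \<noteq> 0 \<and> total_degree_le P d} \<subseteq> {P. P \<noteq> 0 \<and> total_degree_le P d'}"
    using assms by (auto simp: total_degree_le_def intro: order_trans)
qed simp

section \<open>Counting zeros in the disc of radius 1/4\<close>

lemma norm_poly_unit_circle_le:
  fixes p :: "complex poly"
  assumes "degree p \<le> d" "\<And>i. i \<le> d \<Longrightarrow> norm (coeff p i) \<le> H" "norm z = 1"
  shows "norm (poly p z) \<le> real (d + 1) * H"
proof -
  have "norm (poly p z) \<le> (\<Sum>i\<le>degree p. norm (coeff p i))"
    unfolding poly_altdef by (rule sum_norm_le) (simp add: norm_mult norm_power assms)
  also have "\<dots> \<le> (\<Sum>i\<le>d. norm (coeff p i))" using assms by (intro sum_mono2) auto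
  also have "\<dots> \<le> real (card {..d}) * H" using assms by (intro sum_bounded_above) auto
  finally show ?thesis by simp
qed

text \<open>Let \<open>H\<close> be the largest modulus of a coefficient of the \<open>p j\<close>.
  Some Taylor coefficient is bounded below by a multiple of \<open>H\<close>, while on the unit
  circle the function is at most \<open>(d + 1)^2 * H\<close>. In the comparison through
  \<open>num_zeros_and_fps_nth_decay\<close> the factor \<open>H\<close> cancels, leaving an
  inequality for \<open>K\<close> that depends on the \<open>p j\<close> only through
  \<open>K\<close>.\<close>

lemma num_zeros_poly_combination:
  fixes f :: "complex \<Rightarrow> complex" and p :: "nat \<Rightarrow> complex poly"
  assumes f: "f analytic_on cball 0 1" "\<And>z. z \<in> cball 0 1 \<Longrightarrow> norm (f z) \<le> 1"
    and F: "f has_fps_expansion F"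
    and gap: "\<And>m. N < m \<Longrightarrow> m < L \<Longrightarrow> fps_nth F m = 0" and nz: "fps_nth F N \<noteq> 0"
    and dN: "d < N" "d + d * N < L"
    and deg: "\<And>j. j \<le> d \<Longrightarrow> degree (p j) \<le> d" and p: "j \<le> d" "p j \<noteq> 0"
  defines "\<delta> \<equiv> norm (fps_nth F N) ^ d"
  obtains K where "num_zeros (\<lambda>z. \<Sum>j\<le>d. poly (p j) z * f z ^ j) (cball 0 (1/4)) = enat K"
    "1 \<le> (2 / \<delta>) * real (d + 1) ^ 2 * (4 * (1 + 2 / \<delta>)) ^ (d + d * N) * (2/3) ^ K"
proof -
  define g where "g = (\<lambda>z. \<Sum>j\<le>d. poly (p j) z * f z ^ j)"
  define G where "G = (\<Sum>j\<le>d. fps_of_poly (p j) * F ^ j)"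
  define M where "M = d + d * N"
  define c where "c = (\<lambda>(i, j). norm (coeff (p j) i))"
  define H where "H = Max (c ` ({..d} \<times> {..d}))"
  have \<delta>: "\<delta> > 0" using nz by (simp add: \<delta>_def)
  have c_le: "norm (coeff (p j) i) \<le> H" if "i \<le> d" "j \<le> d" for i j
    unfolding H_def using that by (intro Max_ge) (auto simp: c_def intro!: image_eqI[of _ _ "(i, j)"])
  have "H \<in> c ` ({..d} \<times> {..d})" unfolding H_def by (intro Max_in) auto
  then obtain i\<^sub>0 j\<^sub>0 where ij: "i\<^sub>0 \<le> d" "j\<^sub>0 \<le> d" "H = norm (coeff (p j\<^sub>0) i\<^sub>0)"
    by (auto simp: c_def)
  have "0 < norm (coeff (p j) (degree (p j)))" using p by simp
  then have H: "H > 0" using c_le[OF deg[OF p(1)] p(1)] by linarith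
  have "\<exists>t\<le>M. H * (\<delta> / 2) / (1 + 2 / \<delta>) ^ M \<le> norm (fps_nth G t)"
    unfolding G_def \<delta>_def M_def ij(3)
    by (rule fps_poly_combination_lower_bound[OF gap nz dN fps_nth_power_le_one[OF f F] deg ij(1,2)])
  then obtain t where t: "t \<le> M" "H * (\<delta> / 2) / (1 + 2 / \<delta>) ^ M \<le> norm (fps_nth G t)"
    by blast
  have R: "1 + 2 / \<delta> > 0" using \<delta> by (intro add_pos_pos) auto
  have "0 < H * (\<delta> / 2) / (1 + 2 / \<delta>) ^ M"
    using H \<delta> R by (intro divide_pos_pos mult_pos_pos zero_less_power) auto
  with t(2) have t0: "fps_nth G t \<noteq> 0" by auto
  have "poly q analytic_on cball 0 1" for q :: "complex poly"
    unfolding poly_altdef[abs_def] by (intro analytic_intros)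
  then have g: "g analytic_on cball 0 1" unfolding g_def by (intro analytic_intros f(1))
  have gb: "norm (g z) \<le> real (d + 1) ^ 2 * H" if "norm z = 1" for z
  proof -
    have "norm (g z) \<le> (\<Sum>j\<le>d. real (d + 1) * H)"
      unfolding g_def
    proof (rule sum_norm_le)
      fix j assume j: "j \<in> {..d}"
      have "norm (poly (p j) z) * norm (f z) ^ j \<le> real (d + 1) * H * 1"
      proof (rule mult_mono)
        show "norm (poly (p j) z) \<le> real (d + 1) * H"
          using j c_le deg that by (intro norm_poly_unit_circle_le) auto
        show "norm (f z) ^ j \<le> 1" using f(2)[of z] that by (intro power_le_one) auto
      qed (use H in auto)
      then show "norm (poly (p j) z * f z ^ j) \<le> real (d + 1) * H"
        by (simp add: norm_mult norm_power)
    qed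
    then show ?thesis by (simp add: power2_eq_square)
  qed
  have gG: "g has_fps_expansion G"
    unfolding g_def G_def by (rule has_fps_expansion_poly_combination[OF F])
  obtain K where K: "num_zeros g (cball 0 (1/4)) = enat K"
      "norm (fps_nth G t) \<le> real (d + 1) ^ 2 * H * (2/3) ^ K * 4 ^ t"
    by (rule num_zeros_and_fps_nth_decay[OF g gb gG t0])
  have "H * (\<delta> / 2) / (1 + 2 / \<delta>) ^ M \<le> real (d + 1) ^ 2 * H * (2/3) ^ K * 4 ^ t"
    using t(2) K(2) by linarith
  also have "\<dots> \<le> real (d + 1) ^ 2 * H * (2/3) ^ K * 4 ^ M"
    using H t(1) by (intro mult_left_mono power_increasing) auto
  finally have "H * \<delta> \<le> 2 * (real (d + 1) ^ 2 * H * (2/3) ^ K * 4 ^ M) * (1 + 2 / \<delta>) ^ M"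
    using R by (simp add: pos_divide_le_eq)
  also have "\<dots> = H * \<delta> * ((2 / \<delta>) * real (d + 1) ^ 2 * (4 * (1 + 2 / \<delta>)) ^ M * (2/3) ^ K)"
    unfolding power_mult_distrib[of 4 "1 + 2 / \<delta>" M] using \<delta> by simp
  finally have "1 \<le> (2 / \<delta>) * real (d + 1) ^ 2 * (4 * (1 + 2 / \<delta>)) ^ M * (2/3) ^ K"
    using H \<delta> by simp
  with K(1) that show ?thesis unfolding g_def M_def by blast
qed

text \<open>Each factor is replaced by an exponential using \<open>1 + x \<le> exp x\<close>, and
  exponents are compared. The 11 comes from
  \<open>4 * (1 + 2 / \<delta>) \<le> 12 / \<delta>\<close> and \<open>12 \<le> exp 11\<close>; the
  outer 3 comes from \<open>2/3 \<le> exp (-1/3)\<close>.\<close>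

lemma zero_count_le:
  fixes \<delta> E :: real
  assumes ineq: "1 \<le> (2 / \<delta>) * real (d + 1) ^ 2 * (4 * (1 + 2 / \<delta>)) ^ M * (2/3) ^ K"
    and \<delta>: "\<delta> \<ge> exp (- E)" "\<delta> \<le> 1"
  shows "real K \<le> 3 * (1 + 2 * real d + E + real M * (11 + E))"
proof -
  have \<delta>0: "\<delta> > 0" using \<delta>(1) by (rule less_le_trans[OF exp_gt_zero])
  have inv: "1 / \<delta> \<le> exp E" using \<delta> \<delta>0 by (simp add: exp_minus field_simps)
  have "exp (1::real) \<ge> 2" using exp_ge_add_one_self[of 1] by simp
  with inv have b1: "2 / \<delta> \<le> exp 1 * exp E"
    using mult_mono[of 2 "exp 1" "1 / \<delta>" "exp E"] \<delta>0 by simp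
  have b2: "real (d + 1) ^ 2 \<le> exp (real d) ^ 2"
    using exp_ge_add_one_self[of "real d"] by (intro power_mono) (auto simp: add.commute)
  have "4 * (1 + 2 / \<delta>) \<le> 12 * (1 / \<delta>)" using \<delta> \<delta>0 by (simp add: field_simps)
  also have "\<dots> \<le> exp 11 * exp E"
    using inv exp_ge_add_one_self[of 11] \<delta>0 by (intro mult_mono) auto
  finally have b3: "(4 * (1 + 2 / \<delta>)) ^ M \<le> exp (11 + E) ^ M"
    using \<delta>0 by (intro power_mono) (auto simp: exp_add)
  have b4: "(2/3) ^ K \<le> exp (-1/3 :: real) ^ K"
    using exp_ge_add_one_self[of "-1/3"] by (intro power_mono) auto
  define W where "W = 1 + 2 * real d + E + real M * (11 + E) - real K / 3"
  have "(2 / \<delta>) * real (d + 1) ^ 2 * (4 * (1 + 2 / \<delta>)) ^ M * (2/3) ^ K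
      \<le> (exp 1 * exp E) * exp (real d) ^ 2 * exp (11 + E) ^ M * exp (-1/3) ^ K"
    using \<delta>0 by (intro mult_mono b1 b2 b3 b4) auto
  also have "\<dots> = exp W"
  proof -
    have "W = (1 + E) + 2 * real d + real M * (11 + E) + real K * (-1/3)"
      by (simp add: W_def)
    then show ?thesis
      unfolding exp_of_nat_mult[symmetric] of_nat_numeral
      by (simp only: exp_add exp_of_nat_mult[symmetric] of_nat_numeral[where 'a = real, symmetric])
  qed
  finally have "1 \<le> exp W" using ineq by linarith
  then have "0 \<le> W" by (simp only: one_le_exp_iff)
  then show ?thesis unfolding W_def by (simp add: field_simps)
qed

lemma max_zeros_le:
  fixes f :: "complex \<Rightarrow> complex"
  assumes f: "f analytic_on cball 0 1" "\<And>z. z \<in> cball 0 1 \<Longrightarrow> norm (f z) \<le> 1"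
    and F: "f has_fps_expansion F"
    and gap: "\<And>m. N < m \<Longrightarrow> m < L \<Longrightarrow> fps_nth F m = 0" and nz: "fps_nth F N \<noteq> 0"
    and dN: "d < N" "d + d * N < L"
    and E: "exp (- E) \<le> norm (fps_nth F N) ^ d"
  shows "ereal_of_enat (max_zeros f (cball 0 (1/4)) d)
      \<le> ereal (3 * (1 + 2 * real d + E + real (d + d * N) * (11 + E)))"
proof -
  define X where "X = 3 * (1 + 2 * real d + E + real (d + d * N) * (11 + E))"
  have "norm (fps_nth F N) \<le> 1" using fps_nth_power_le_one[OF f F, of 1] by simp
  then have \<delta>1: "norm (fps_nth F N) ^ d \<le> 1" by (intro power_le_one) auto
  have "E \<ge> 0" using order_trans[OF E \<delta>1] by simp
  then have "X \<ge> 0" by (simp add: X_def)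
  \<comment> \<open>The maximum is taken in \<open>enat\<close>, so the real bound is rounded down
    before taking the supremum.\<close>
  have "max_zeros f (cball 0 (1/4)) d \<le> enat (nat \<lfloor>X\<rfloor>)"
    unfolding max_zeros_def
  proof (rule SUP_least, clarify)
    fix p :: "nat \<Rightarrow> complex poly" and j
    assume p: "\<forall>j\<le>d. degree (p j) \<le> d" "j \<le> d" "p j \<noteq> 0"
    then have deg: "degree (p j) \<le> d" if "j \<le> d" for j using that by blast
    obtain K where K: "num_zeros (\<lambda>z. \<Sum>j\<le>d. poly (p j) z * f z ^ j) (cball 0 (1/4)) = enat K"
      "1 \<le> (2 / norm (fps_nth F N) ^ d) * real (d + 1) ^ 2
          * (4 * (1 + 2 / norm (fps_nth F N) ^ d)) ^ (d + d * N) * (2/3) ^ K"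
      by (rule num_zeros_poly_combination[where p = p and j = j, OF f F gap nz dN deg p(2,3)])
    have "real K \<le> X" unfolding X_def by (rule zero_count_le[OF K(2) E \<delta>1])
    then have "K \<le> nat \<lfloor>X\<rfloor>" by (simp add: le_nat_floor)
    then show "num_zeros (\<lambda>z. \<Sum>j\<le>d. poly (p j) z * f z ^ j) (cball 0 (1/4)) \<le> enat (nat \<lfloor>X\<rfloor>)"
      using K(1) by simp
  qed
  then have "ereal_of_enat (max_zeros f (cball 0 (1/4)) d) \<le> ereal_of_enat (enat (nat \<lfloor>X\<rfloor>))"
    by (simp only: ereal_of_enat_le_iff)
  also have "\<dots> \<le> ereal X" using \<open>X \<ge> 0\<close> by simp
  finally show ?thesis by (simp only: X_def)
qed

section \<open>Choice of the gap and the final estimates\<close>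

lemma strict_mono_bracket:
  fixes m :: "nat \<Rightarrow> nat"
  assumes "strict_mono m" "m 0 \<le> d"
  obtains k where "m k \<le> d" "d < m (Suc k)"
proof -
  have "d < m (Suc d)" using strict_mono_imp_increasing[OF assms(1), of "Suc d"] by simp
  then obtain j where j: "d < m j" "\<And>i. i < j \<Longrightarrow> \<not> d < m i"
    using exists_least_iff[of "\<lambda>j. d < m j"] by blast
  then obtain k where "j = Suc k" using assms(2) by (cases j) auto
  then show ?thesis using j that[of k] by (auto simp: not_less)
qed

text \<open>With \<open>D = d powr q\<^sup>2\<close>, from \<open>8 * d \<le> d^4 \<le> D\<close>
  comes \<open>1 + 2 * d \<le> D\<close>, and \<open>E \<le> D * E\<close>. The left side is then at
  most \<open>36 * D + 6 * D * E\<close>, well below \<open>10 * D * (9 + 5 * E)\<close>; finally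
  \<open>9 = 1 + 8\<close> with \<open>8 \<le> q * d^2\<close>.\<close>

lemma polynomial_bound_slack:
  fixes d :: nat and p q :: real
  assumes d: "d \<ge> 2" and q: "q > 2" and p: "p > 0" and M: "real M \<le> real d powr q\<^sup>2"
  defines "E \<equiv> real d powr (p * q + 1)"
  shows "3 * (1 + 2 * real d + E + real M * (11 + E))
    \<le> 10 * (2 * real d) powr q\<^sup>2 * (1 + q * (real d)\<^sup>2 + 5 * real d powr (p * q + 3))"
proof -
  define D where "D = real d powr q\<^sup>2"
  have q2: "q\<^sup>2 \<ge> 4" using q power_mono[of 2 q 2] by simp
  have d2: "real d \<ge> 2" using d by simp
  have E1: "E \<ge> 1" unfolding E_def using d2 p q by (intro ge_one_powr_ge_zero) auto
  have "real d ^ 4 = real d powr 4" using d2 by (simp add: powr_numeral)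
  also have "\<dots> \<le> D" unfolding D_def using d2 q2 by (intro powr_mono) auto
  finally have "real d ^ 3 * real d \<le> D" by (simp add: eval_nat_numeral)
  moreover have "2 ^ 3 * real d \<le> real d ^ 3 * real d"
    using d2 by (intro mult_right_mono power_mono) auto
  ultimately have "2 ^ 3 * real d \<le> D" by (rule order_trans[rotated])
  then have D: "1 + 2 * real d \<le> D" using d2 by simp
  then have D1: "D \<ge> 1" using d2 by linarith
  have DE: "E \<le> D * E" using D1 E1 by simp
  have "3 * (1 + 2 * real d + E + real M * (11 + E)) \<le> 3 * (D + D * E + D * (11 + E))"
    using D DE M E1 unfolding D_def[symmetric]
    by (intro mult_left_mono add_mono mult_right_mono) auto
  also have "\<dots> \<le> 10 * D * (9 + 5 * E)"
    using D1 E1 by (simp add: algebra_simps)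
  also have "\<dots> \<le> 10 * (2 * real d) powr q\<^sup>2 * (1 + q * (real d)\<^sup>2 + 5 * real d powr (p * q + 3))"
  proof -
    have a: "D \<le> (2 * real d) powr q\<^sup>2" unfolding D_def by (intro powr_mono2) auto
    have "2 * 2\<^sup>2 \<le> q * (real d)\<^sup>2" using q d2 by (intro mult_mono power_mono) auto
    moreover have "E \<le> real d powr (p * q + 3)" unfolding E_def using d2 by (intro powr_mono) auto
    ultimately have b: "9 + 5 * E \<le> 1 + q * (real d)\<^sup>2 + 5 * real d powr (p * q + 3)" by simp
    show ?thesis using a b D1 E1 by (intro mult_mono) auto
  qed
  finally show ?thesis .
qed

text \<open>The explicit bounds start at \<open>d = n 1\<close>. The polynomial \<open>Y\<close>
  already gives multiplicity \<open>n 1\<close> at 0, so the strict index bound must fail as long as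
  \<open>d powr q\<^sup>2 \<le> n 1\<close>, in particular at \<open>d = 1\<close>. Polynomial
  growth is asserted for every \<open>d \<ge> 1\<close>.\<close>

theorem theorem3p4p5:
  fixes f :: "complex \<Rightarrow> complex" and a :: "nat \<Rightarrow> complex" and n :: "nat \<Rightarrow> nat" and q :: real
  assumes f_analytic: "f analytic_on cball 0 1"
    and f_series: "\<And>z. z \<in> cball 0 1 \<Longrightarrow> (\<lambda>k. a (Suc k) * z ^ n (Suc k)) sums f z"
    and f_bounded: "\<And>z. z \<in> cball 0 1 \<Longrightarrow> norm (f z) \<le> 1"
    and a_nonzero: "\<And>k. k \<ge> 1 \<Longrightarrow> a k \<noteq> 0"
    and n_pos: "\<And>k. k \<ge> 1 \<Longrightarrow> n k > 0"
    and q_gt_2: "q > 2"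
    and n_lower: "\<And>k. k \<ge> 1 \<Longrightarrow> (n k)\<^sup>2 < n (Suc k)"
    and n_upper: "\<And>k. k \<ge> 1 \<Longrightarrow> real (n (Suc k)) \<le> real (n k) powr q"
  shows "(\<exists>C N :: nat. \<forall>d\<ge>1. transcendence_index f d \<le> enat (C * d ^ N)) \<and>
    (\<forall>d\<ge>n 1. ereal_of_enat (transcendence_index f d) < ereal (real d powr q\<^sup>2)) \<and>
    (\<forall>p>0. (\<forall>k\<ge>1. norm (a k) \<ge> exp (- (real (n k) powr p))) \<longrightarrow>
       (\<forall>d\<ge>n 1. ereal_of_enat (max_zeros f (cball 0 (1/4)) d)
          \<le> ereal (10 * (2 * real d) powr q\<^sup>2
                     * (1 + q * (real d)\<^sup>2 + 5 * real d powr (p * q + 3)))))"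
proof -
  \<comment> \<open>The hypotheses constrain \<open>n\<close> from index 1 on; after the shift,
    monotonicity holds on all indices.\<close>
  define m where "m = (\<lambda>k. n (Suc k))"
  have m_lower: "(m k)\<^sup>2 < m (Suc k)" for k using n_lower[of "Suc k"] by (simp add: m_def)
  have m_upper: "real (m (Suc k)) \<le> real (m k) powr q" for k using n_upper[of "Suc k"] by (simp add: m_def)
  have mono: "strict_mono m"
  proof (intro strict_monoI_Suc)
    fix k
    have "m k \<le> (m k)\<^sup>2" by (simp add: power2_eq_square)
    then show "m k < m (Suc k)" using m_lower[of k] by linarith
  qed
  \<comment> \<open>If \<open>n 1 = 1\<close>, the two growth conditions would give
    \<open>1 < n 2 \<le> 1 powr q = 1\<close>.\<close>
  have n1: "n 1 \<ge> 2"
  proof (rule ccontr)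
    assume "\<not> n 1 \<ge> 2"
    then have "n 1 = 1" using n_pos[of 1] by simp
    then show False using n_lower[of 1] n_upper[of 1] by simp
  qed
  obtain F where F: "f has_fps_expansion F" and F_m: "\<And>k. fps_nth F (m k) = a (Suc k)"
      and F_0: "\<And>i. i \<notin> range m \<Longrightarrow> fps_nth F i = 0"
    using lacunary_series_expansion[of "\<lambda>k. a (Suc k)" m f] f_series mono by (auto simp: m_def)
  \<comment> \<open>The witness is the first exponent beyond \<open>d\<close>. One application of
    the upper growth condition bounds it by \<open>d powr q\<close>, a second bounds its successor
    by \<open>d powr q\<^sup>2\<close>.\<close>
  have bracket: "\<exists>k. d < m k \<and> d + d * m k < m (Suc k) \<and> real (m k) \<le> real d powr q
      \<and> real (m (Suc k)) \<le> real d powr q\<^sup>2" if d: "n 1 \<le> d" for d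
  proof -
    have "m 0 \<le> d" using d by (simp add: m_def)
    then obtain k where k: "m k \<le> d" "d < m (Suc k)"
      by (rule strict_mono_bracket[OF mono])
    have "real (m k) powr q \<le> real d powr q" using k q_gt_2 by (intro powr_mono2) auto
    then have 1: "real (m (Suc k)) \<le> real d powr q" using m_upper[of k] by linarith
    then have "real (m (Suc k)) powr q \<le> (real d powr q) powr q"
      using q_gt_2 by (intro powr_mono2) auto
    then have 2: "real (m (Suc (Suc k))) \<le> real d powr q\<^sup>2"
      using m_upper[of "Suc k"] by (simp add: powr_powr power2_eq_square)
    \<comment> \<open>The squared lower growth condition enters here: with \<open>N\<close> the
      witness, \<open>d * (N + 1) \<le> (N - 1) * (N + 1) \<le> N^2\<close>, which is below the next
      exponent.\<close>
    have "d * Suc (m (Suc k)) \<le> (m (Suc k) - 1) * Suc (m (Suc k))"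
      using k by (intro mult_right_mono) auto
    also have "\<dots> \<le> (m (Suc k))\<^sup>2"
      by (cases "m (Suc k)") (auto simp: power2_eq_square)
    also have "\<dots> < m (Suc (Suc k))" by (rule m_lower)
    finally have "d + d * m (Suc k) < m (Suc (Suc k))" by simp
    with k 1 2 show ?thesis by blast
  qed
  have gap: "fps_nth F i = 0" if "m k < i" "i < m (Suc k)" for i k
  proof (rule F_0, rule notI)
    assume "i \<in> range m"
    then obtain j where "i = m j" by blast
    then have "k < j" "j < Suc k" using that strict_mono_less[OF mono] by auto
    then show False by simp
  qed
  have nz: "fps_nth F (m k) \<noteq> 0" for k using a_nonzero[of "Suc k"] F_m[of k] by simp

  have index: "ereal_of_enat (transcendence_index f d) < ereal (real d powr q\<^sup>2)" if d: "n 1 \<le> d" for d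
  proof -
    obtain k where k: "d < m k" "d + d * m k < m (Suc k)" "real (m (Suc k)) \<le> real d powr q\<^sup>2"
      using bracket[OF d] by blast
    have "transcendence_index f d \<le> enat (d + d * m k)"
      by (rule transcendence_index_le[OF f_analytic f_bounded F gap nz k(1,2)])
    then have "ereal_of_enat (transcendence_index f d) \<le> ereal_of_enat (enat (d + d * m k))"
      by (simp only: ereal_of_enat_le_iff)
    also have "\<dots> = ereal (real (d + d * m k))" by simp
    also have "\<dots> < ereal (real d powr q\<^sup>2)"
      using k(2,3) by (metis ereal_less(2) less_ereal.simps(1) less_le_trans of_nat_less_iff)
    finally show ?thesis .
  qed

  have poly_growth: "transcendence_index f d \<le> enat (n 1 ^ nat \<lceil>q\<^sup>2\<rceil> * d ^ nat \<lceil>q\<^sup>2\<rceil>)"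
    if d: "1 \<le> d" for d
  proof -
    let ?N = "nat \<lceil>q\<^sup>2\<rceil>"
    \<comment> \<open>Multiplying by \<open>n 1\<close> moves every \<open>d \<ge> 1\<close> into
      the range of \<open>index\<close>; monotonicity in \<open>d\<close> transfers the bound back,
      and rounding the exponent up makes it a natural number.\<close>
    define d' where "d' = n 1 * d"
    have d': "n 1 \<le> d'" "d \<le> d'" using d n1 by (auto simp: d'_def)
    have "ereal_of_enat (transcendence_index f d) \<le> ereal_of_enat (transcendence_index f d')"
      using transcendence_index_mono[OF d'(2)] by (simp only: ereal_of_enat_le_iff)
    also have "\<dots> \<le> ereal (real d' powr q\<^sup>2)" using index[OF d'(1)] by (rule less_imp_le)
    also have "real d' powr q\<^sup>2 \<le> real d' powr real ?N"
      using d' n1 by (intro powr_mono) linarith+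
    also have "real d' powr real ?N = real (d' ^ ?N)"
      using d' n1 by (subst powr_realpow) auto
    finally have "ereal_of_enat (transcendence_index f d) \<le> ereal_of_enat (enat (d' ^ ?N))" by simp
    then show ?thesis by (simp only: ereal_of_enat_le_iff d'_def power_mult_distrib)
  qed

  have zeros: "ereal_of_enat (max_zeros f (cball 0 (1/4)) d)
      \<le> ereal (10 * (2 * real d) powr q\<^sup>2 * (1 + q * (real d)\<^sup>2 + 5 * real d powr (p * q + 3)))"
    if p: "p > 0" and a_ge: "\<forall>k\<ge>1. norm (a k) \<ge> exp (- (real (n k) powr p))" and d: "n 1 \<le> d" for p d
  proof -
    obtain k where k: "d < m k" "d + d * m k < m (Suc k)" "real (m k) \<le> real d powr q"
        "real (m (Suc k)) \<le> real d powr q\<^sup>2"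
      using bracket[OF d] by blast
    have d2: "d \<ge> 2" using d n1 by simp
    \<comment> \<open>The lower bound on the leading coefficient, raised to the power
      \<open>d\<close>, gives \<open>exp (- d * N powr p)\<close> with \<open>N = m k\<close>; then
      \<open>N \<le> d powr q\<close> produces the exponent \<open>p * q + 1\<close>.\<close>
    have "real d * real (m k) powr p \<le> real d * (real d powr q) powr p"
      using k(3) p by (intro mult_left_mono powr_mono2) auto
    also have "\<dots> = real d powr (p * q + 1)"
      using d2 by (simp add: powr_powr powr_add mult.commute)
    finally have "exp (- (real d powr (p * q + 1))) \<le> exp (real d * - (real (m k) powr p))" by simp
    also have "\<dots> = exp (- (real (m k) powr p)) ^ d" by (rule exp_of_nat_mult)
    also have "\<dots> \<le> norm (fps_nth F (m k)) ^ d"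
      using a_ge[rule_format, of "Suc k"] F_m[of k] by (intro power_mono) (auto simp: m_def)
    finally have E: "exp (- (real d powr (p * q + 1))) \<le> norm (fps_nth F (m k)) ^ d" .
    have M: "real (d + d * m k) \<le> real d powr q\<^sup>2" using k(2,4) by linarith
    have "ereal_of_enat (max_zeros f (cball 0 (1/4)) d) \<le> ereal (3 * (1 + 2 * real d
        + real d powr (p * q + 1) + real (d + d * m k) * (11 + real d powr (p * q + 1))))"
      by (rule max_zeros_le[OF f_analytic f_bounded F gap nz k(1,2) E])
    also have "\<dots> \<le> ereal (10 * (2 * real d) powr q\<^sup>2 * (1 + q * (real d)\<^sup>2 + 5 * real d powr (p * q + 3)))"
      using polynomial_bound_slack[OF d2 q_gt_2 p M] by simp
    finally show ?thesis .
  qed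
  show ?thesis using poly_growth index zeros by blast
qed
end
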